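(* Let $l\in\mathbb{N}-\frac12$ and let $\mathfrak{g}$ be the $l$-conformal Galilei algebra over $\mathbb{C}$. Let $\delta:\mathfrak{g}\to\mathfrak{g}$ be the linear map with $\delta(h)=\delta(e)=\delta(f)=0$, $\delta(z)=z$ and $\delta(p_i)=\frac12 p_i$ for $i=0,1,\dots,2l$. Then $$\mathrm{Der}(\mathfrak{g})=\mathbb{C}\delta\oplus\mathrm{ad}(\mathfrak{g}).$$
   Context: $\mathbb{N}$ denotes the positive integers, so $l\in\{\frac12,\frac32,\frac52,\dots\}$. The ($l$-)conformal Galilei algebra $\mathfrak{g}$ is the complex Lie algebra with basis $\{e,h,f,p_k,z\mid k=0,1,\dots,2l\}$ and Lie bracket determined by $[h,e]=2e$, $[h,f]=-2f$, $[e,f]=h$, $[h,p_k]=2(l-k)p_k$, $[e,p_k]=k\,p_{k-1}$, $[f,p_k]=(2l-k)p_{k+1}$, $[z,\mathfrak{g}]=0$, and $[p_k,p_{k'}]=\delta_{k+k',2l}(-1)^{k+l+\frac12}k!(2l-k)!\,z$ for $k,k'=0,1,\dots,2l$ (here $\delta_{k+k',2l}$ is the Kronecker delta; terms with coefficient $0$ are omitted). A derivation of $\mathfrak{g}$ is a linear map $D:\mathfrak{g}\to\mathfrak{g}$ with $D([x,y])=[D(x),y]+[x,D(y)]$ for all $x,y\in\mathfrak{g}$; $\mathrm{Der}(\mathfrak{g})$ is the space of all derivations. For $a\in\mathfrak{g}$, $\mathrm{ad}(a)(x)=[a,x]$, and $\mathrm{ad}(\mathfrak{g})=\{\mathrm{ad}(a)\mid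 a\in\mathfrak{g}\}$ is the space of inner derivations. *)

theory Defs
  imports "HOL-Analysis.Analysis"
begin

locale complex_lie_algebra = vector_space scl
  for scl :: "complex \<Rightarrow> 'a::ab_group_add \<Rightarrow> 'a" +
  fixes bracket :: "'a \<Rightarrow> 'a \<Rightarrow> 'a"
  assumes linear_bracket_left: "Vector_Spaces.linear scl scl (\<lambda>x. bracket x y)"
    and linear_bracket_right: "Vector_Spaces.linear scl scl (\<lambda>y. bracket x y)"
    and bracket_self: "bracket x x = 0"
    and jacobi: "bracket x (bracket y w) + bracket y (bracket w x) + bracket w (bracket x y) = 0"

definition derivations ::
  "(complex \<Rightarrow> 'a::ab_group_add \<Rightarrow> 'a) \<Rightarrow> ('a \<Rightarrow> 'a \<Rightarrow> 'a) \<Rightarrow> ('a \<Rightarrow> 'a) set" where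
  "derivations scl bracket =
    {D. Vector_Spaces.linear scl scl D \<and>
        (\<forall>x y. D (bracket x y) = bracket (D x) y + bracket x (D y))}"

definition ad :: "('a \<Rightarrow> 'a \<Rightarrow> 'a) \<Rightarrow> 'a \<Rightarrow> 'a \<Rightarrow> 'a" where
  "ad bracket a = (\<lambda>x. bracket a x)"

text \<open>Internal direct sum \<open>U = A \<oplus> B\<close> for linear subspaces \<open>A\<close>, \<open>B\<close> of a space of maps
  with pointwise operations.\<close>

definition is_direct_sum ::
  "('a \<Rightarrow> 'b::ab_group_add) set \<Rightarrow> ('a \<Rightarrow> 'b) set \<Rightarrow> ('a \<Rightarrow> 'b) set \<Rightarrow> bool" where
  "is_direct_sum U A B \<longleftrightarrow>
    U = {\<lambda>x. a x + b x | a b. a \<in> A \<and> b \<in> B} \<and> A \<inter> B = {\<lambda>x. 0}"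

text \<open>The parameter is \<open>m = 1, 2, \<dots>\<close> with \<open>l = m - 1/2\<close>, so that \<open>2 * l\<close> is the natural number
  \<open>2 * m - 1\<close> and \<open>l + 1/2 = m\<close>. The values \<open>p k\<close> for \<open>k > 2 * l\<close> are irrelevant: together
  with \<open>p (0 - 1)\<close> they occur below only with coefficient 0.\<close>

definition galilei_l :: "nat \<Rightarrow> complex" where
  "galilei_l m = of_nat m - 1/2"

locale conformal_galilei = complex_lie_algebra scl bracket
  for scl :: "complex \<Rightarrow> 'a::ab_group_add \<Rightarrow> 'a"
    and bracket :: "'a \<Rightarrow> 'a \<Rightarrow> 'a" +
  fixes m :: nat and e h f :: 'a and p :: "nat \<Rightarrow> 'a" and z :: 'a
  assumes m_pos: "m \<ge> 1"
    and basis_distinct: "distinct ([e, h, f] @ map p [0..<2*m] @ [z])"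
    and basis_independent: "independent (set ([e, h, f] @ map p [0..<2*m] @ [z]))"
    and basis_span: "span (set ([e, h, f] @ map p [0..<2*m] @ [z])) = UNIV"
    and bracket_h_e: "bracket h e = scl 2 e"
    and bracket_h_f: "bracket h f = scl (-2) f"
    and bracket_e_f: "bracket e f = h"
    and bracket_h_p: "k \<le> 2*m-1 \<Longrightarrow> bracket h (p k) = scl (2 * (galilei_l m - of_nat k)) (p k)"
    and bracket_e_p: "k \<le> 2*m-1 \<Longrightarrow> bracket e (p k) = scl (of_nat k) (p (k - 1))"
    and bracket_f_p: "k \<le> 2*m-1 \<Longrightarrow> bracket f (p k) = scl (2 * galilei_l m - of_nat k) (p (k + 1))"
    and bracket_z: "bracket z x = 0"
    and bracket_p_p: "k \<le> 2*m-1 \<Longrightarrow> k' \<le> 2*m-1 \<Longrightarrow> bracket (p k) (p k') =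
          scl (if k + k' = 2*m-1 then (-1) ^ (k + m) * fact k * fact (2*m-1-k) else 0) z"

lemma (in conformal_galilei) half_derivation_exists:
  "\<exists>\<delta>. Vector_Spaces.linear scl scl \<delta> \<and> \<delta> h = 0 \<and> \<delta> e = 0 \<and> \<delta> f = 0 \<and> \<delta> z = z \<and>
     (\<forall>i\<le>2*m-1. \<delta> (p i) = scl (1/2) (p i))"
proof -
  interpret vector_space_pair scl scl ..
  let ?B = "set ([e, h, f] @ map p [0..<2*m] @ [z])"
  define \<phi> where "\<phi> x = (if x = z then z else if x \<in> p ` {..<2*m} then scl (1/2) x else 0)" for x
  obtain \<delta> where \<delta>: "Vector_Spaces.linear scl scl \<delta>" "\<forall>x\<in>?B. \<delta> x = \<phi> x"
    using linear_independent_extend[OF basis_independent, of \<phi>] by blast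
  have ne: "h \<noteq> z" "e \<noteq> z" "f \<noteq> z" "i < 2*m \<Longrightarrow> p i \<noteq> z"
    "h \<notin> p ` {..<2*m}" "e \<notin> p ` {..<2*m}" "f \<notin> p ` {..<2*m}" for i
    using basis_distinct by (auto simp: atLeast0LessThan)
  have "\<delta> h = 0" "\<delta> e = 0" "\<delta> f = 0" "\<delta> z = z" using \<delta>(2) ne by (auto simp: \<phi>_def)
  moreover have "\<delta> (p i) = scl (1/2) (p i)" if "i \<le> 2*m-1" for i
  proof -
    have "i < 2*m" using that m_pos by simp
    then show ?thesis using \<delta>(2) ne by (auto simp: \<phi>_def)
  qed
  ultimately show ?thesis using \<delta>(1) by blast
qed

text \<open>The axioms of \<^locale>\<open>conformal_galilei\<close> are satisfiable for every \<open>m \<ge> 1\<close>: on coordinate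
  vectors \<open>((e, h, f), z, p)\<close>, with \<open>p\<close> indexed by a type of cardinality \<open>2 * m\<close>, the bracket
  extended bilinearly from the basis satisfies the Jacobi identity. Here \<open>model_act m (a, b, c)\<close> is the action of
  \<open>a e + b h + c f\<close> on \<open>p\<close>-coordinates and \<open>model_form\<close> the coefficient of \<open>z\<close>.\<close>

definition model_act :: "nat \<Rightarrow> complex \<times> complex \<times> complex \<Rightarrow> (nat \<Rightarrow> complex) \<Rightarrow> nat \<Rightarrow> complex" where
  "model_act m = (\<lambda>(a, b, c) u k. a * of_nat (k + 1) * u (k + 1) + b * (of_nat (2*m) - 1 - 2 * of_nat k) * u k
     + (if k = 0 then 0 else c * (of_nat (2*m) - of_nat k) * u (k - 1)))"

definition model_coeff :: "nat \<Rightarrow> nat \<Rightarrow> complex" where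
  "model_coeff m k = (-1) ^ (k + m) * fact k * fact (2*m-1-k)"

definition model_form :: "nat \<Rightarrow> (nat \<Rightarrow> complex) \<Rightarrow> (nat \<Rightarrow> complex) \<Rightarrow> complex" where
  "model_form m u v = (\<Sum>k<2*m. model_coeff m k * u k * v (2*m-1-k))"

definition model_sl2_bracket :: "complex \<times> complex \<times> complex \<Rightarrow> complex \<times> complex \<times> complex \<Rightarrow> complex \<times> complex \<times> complex" where
  "model_sl2_bracket = (\<lambda>(a, b, c) (a', b', c'). (2 * (b * a' - b' * a), a * c' - a' * c, 2 * (b' * c - b * c')))"

lemma galilei_model_act_sl2: "model_act m (model_sl2_bracket x y) u k = model_act m x (model_act m y u) k - model_act m y (model_act m x u) k"
  by (cases k; cases x; cases y) (auto simp: model_act_def model_sl2_bracket_def algebra_simps)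

lemma galilei_model_act_support: 
  assumes "\<And>k. k \<ge> 2*m \<Longrightarrow> u k = 0" "k \<ge> 2*m" shows "model_act m x u k = 0"
proof -
  have "k = 2*m \<or> u (k-1) = 0" using assms by (cases "k = 2*m") auto
  then show ?thesis using assms by (auto simp: model_act_def split: prod.splits)
qed

lemma galilei_model_form_antisym: assumes "m \<ge> 1" shows "model_form m u v = - model_form m v u"
proof -
  have "model_form m u v = (\<Sum>k<2*m. model_coeff m (2*m-1-k) * u (2*m-1-k) * v k)"
    unfolding model_form_def by (subst sum.nat_diff_reindex[symmetric]) (auto intro!: sum.cong)
  also have "\<dots> = (\<Sum>k<2*m. - (model_coeff m k * v k * u (2*m-1-k)))"
  proof (rule sum.cong, goal_cases)
    case (2 k)
    then have k: "k \<le> 2*m-1" by auto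
    have "even (2*m-1-k+m) \<longleftrightarrow> odd (k+m)" using k assms by (simp, presburger)
    then have "(-1::complex) ^ (2*m-1-k+m) = - ((-1) ^ (k+m))"
      by (cases "even (k+m)") auto
    moreover have "2*m-1-(2*m-1-k) = k" using 2 by simp
    ultimately have "model_coeff m (2*m-1-k) = - model_coeff m k" by (simp only: model_coeff_def) simp
    then show ?case by (simp add: algebra_simps)
  qed auto
  finally show ?thesis by (simp add: model_form_def sum_negf)
qed

lemma galilei_model_sg_Suc: "k + 1 < 2*m \<Longrightarrow> model_coeff m (k+1) * (of_nat (2*m) - of_nat (k+1)) = - model_coeff m k * of_nat (k+1)"
proof -
  assume a: "k + 1 < 2*m"
  then obtain j where j: "2*m = k + 2 + j" by (metis Suc_1 add_2_eq_Suc' add_Suc_right less_eq_Suc_le le_Suc_ex Suc_eq_plus1 group_cancel.add1)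
  have "2*m-1-k = Suc j" "2*m-1-(k+1) = j" using j by auto
  moreover have "(of_nat (2*m)::complex) - of_nat (k+1) = of_nat (Suc j)" 
    unfolding j by simp
  ultimately show ?thesis by (simp only: model_coeff_def fact_Suc) (simp add: algebra_simps)
qed

lemma galilei_model_form_invariant:
  assumes u: "\<And>k. k \<ge> 2*m \<Longrightarrow> u k = 0" and v: "\<And>k. k \<ge> 2*m \<Longrightarrow> v k = 0" and m: "m \<ge> 1"
  shows "model_form m (model_act m x u) v = - model_form m u (model_act m x v)"
proof -
  obtain a b c where x: "x = (a, b, c)" by (cases x)
  define t where "t k = - model_coeff m k * (of_nat (2*m) - of_nat k) * u k * v (2*m-k)" for k
  define r where "r k = (if k = 0 then 0 else model_coeff m k * (of_nat (2*m) - of_nat k) * u (k-1) * v (2*m-1-k))" for k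
  have *: "model_coeff m k * model_act m x u k * v (2*m-1-k) + model_coeff m k * u k * model_act m x v (2*m-1-k)
      = a * (t (Suc k) - t k) - c * (r (Suc k) - r k)" if k: "k < 2*m" for k
  proof -
    obtain j where j: "2*m = Suc (k + j)" using k by (metis less_imp_Suc_add add_Suc_right)
    have j1: "2*m - 1 - k = j" "2*m-k = Suc j" "2*m - Suc k = j" "2*m-1-Suc k = j-1" using j by auto
    have c: "of_nat (2*m) = (1 + of_nat k + of_nat j :: complex)" unfolding j by simp
    have c': "of_nat m = (1 + of_nat k + of_nat j :: complex) / 2" using c by (simp add: mult.commute)
    have tS: "t (Suc k) = model_coeff m k * of_nat (k+1) * u (Suc k) * v j"
    proof (cases "k + 1 < 2*m")
      case True then show ?thesis using galilei_model_sg_Suc[OF True] j1 by (simp add: t_def)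
    next
      case False then show ?thesis using k u by (simp add: t_def)
    qed
    have rS: "r (Suc k) = (if j = 0 then 0 else - model_coeff m k * of_nat (k+1) * u k * v (j-1))"
    proof (cases "k + 1 < 2*m")
      case True then show ?thesis using galilei_model_sg_Suc[OF True] j1 j by (simp add: r_def)
    next
      case False then have "j = 0" using j by auto
      then show ?thesis using c by (simp add: r_def)
    qed
    have cc: "(of_nat (2*m)::complex) - of_nat k = of_nat (Suc j)" unfolding c by simp
    have tk: "t k = - model_coeff m k * of_nat (Suc j) * u k * v (Suc j)" by (simp only: t_def j1 cc)
    have rk: "r k = (if k = 0 then 0 else model_coeff m k * of_nat (Suc j) * u (k-1) * v j)"
      by (simp only: r_def j1 cc)
    show ?thesis unfolding tS rS tk rk j1 x model_act_def by (auto simp: c' field_simps)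
  qed
  have "model_form m (model_act m x u) v + model_form m u (model_act m x v) = (\<Sum>k<2*m. a * (t (Suc k) - t k) - c * (r (Suc k) - r k))"
    unfolding model_form_def sum.distrib[symmetric] by (intro sum.cong refl) (simp only: * lessThan_iff)
  also have "\<dots> = a * (t (2*m) - t 0) - c * (r (2*m) - r 0)"
    by (subst sum_subtractf) (simp only: sum_distrib_left[symmetric] sum_lessThan_telescope)
  also have "\<dots> = 0" using u v by (simp add: t_def r_def)
  finally show ?thesis by (simp add: eq_neg_iff_add_eq_0)
qed


context
  fixes m :: nat and g :: "nat \<Rightarrow> 'n::finite"
  assumes m: "m \<ge> 1" and g: "bij_betw g {..<2*m} UNIV"
begin

definition model_coord :: "complex ^ 'n \<Rightarrow> nat \<Rightarrow> complex" where
  "model_coord v k = (if k < 2*m then v $ g k else 0)"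

definition model_vec :: "(nat \<Rightarrow> complex) \<Rightarrow> complex ^ 'n" where
  "model_vec u = (\<chi> i. u (inv_into {..<2*m} g i))"

lemma galilei_model_C_V: "(\<And>k. k \<ge> 2*m \<Longrightarrow> u k = 0) \<Longrightarrow> model_coord (model_vec u) = u"
  using g by (auto simp: model_coord_def model_vec_def fun_eq_iff bij_betw_def inv_into_f_f)

lemma galilei_model_C_eqI: "model_coord v = model_coord w \<Longrightarrow> v = w"
  using g unfolding model_coord_def vec_eq_iff bij_betw_def fun_eq_iff by (metis UNIV_I imageE lessThan_iff)

lemma galilei_model_C_0: "k \<ge> 2*m \<Longrightarrow> model_coord v k = 0" by (simp add: model_coord_def)

lemma galilei_model_C_lin: "model_coord (v + w) = (\<lambda>k. model_coord v k + model_coord w k)" "model_coord (v - w) = (\<lambda>k. model_coord v k - model_coord w k)"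
   "model_coord (c *s v) = (\<lambda>k. c * model_coord v k)" "model_coord 0 = (\<lambda>k. 0)"
  by (auto simp: model_coord_def fun_eq_iff)

lemma galilei_model_C_act: "model_coord (model_vec (model_act m x (model_coord v))) = model_act m x (model_coord v)"
  by (intro galilei_model_C_V galilei_model_act_support galilei_model_C_0)

definition model_scale :: "complex \<Rightarrow> (complex \<times> complex \<times> complex) \<times> complex \<times> (complex ^ 'n) \<Rightarrow> _" where
  "model_scale c = (\<lambda>((a,b,d), t, v). ((c * a, c * b, c * d), c * t, c *s v))"

definition model_bracket :: "(complex \<times> complex \<times> complex) \<times> complex \<times> (complex ^ 'n) \<Rightarrow>
    (complex \<times> complex \<times> complex) \<times> complex \<times> (complex ^ 'n) \<Rightarrow> 
    (complex \<times> complex \<times> complex) \<times> complex \<times> (complex ^ 'n)" where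
  "model_bracket = (\<lambda>(x, t, v) (y, s, w). (model_sl2_bracket x y, model_form m (model_coord v) (model_coord w), 
     model_vec (model_act m x (model_coord w)) - model_vec (model_act m y (model_coord v))))"

lemma galilei_model_vs: "vector_space model_scale"
  by unfold_locales (auto simp: model_scale_def algebra_simps vec_eq_iff)

lemma galilei_model_V_lin: "model_vec (\<lambda>k. u k + w k) = model_vec u + model_vec w" "model_vec (\<lambda>k. u k - w k) = model_vec u - model_vec w" "model_vec (\<lambda>k. c * u k) = c *s model_vec u"
  by (auto simp: model_vec_def vec_eq_iff)

lemma galilei_model_act_scm: "model_act m x (\<lambda>k. c * u k) = (\<lambda>k. c * model_act m x u k)"
  "model_act m (c * a, c * b, c * d) u = (\<lambda>k. c * model_act m (a, b, d) u k)"
  "model_act m (a * c, b * c, d * c) u = (\<lambda>k. c * model_act m (a, b, d) u k)"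
  "model_act m x (\<lambda>k. u k + v k) = (\<lambda>k. model_act m x u k + model_act m x v k)"
  "model_act m x (\<lambda>k. u k - v k) = (\<lambda>k. model_act m x u k - model_act m x v k)"
  "model_act m (x + y) u = (\<lambda>k. model_act m x u k + model_act m y u k)"
  by (auto simp: model_act_def algebra_simps fun_eq_iff split: prod.splits)

lemma galilei_model_form_lin: "model_form m (\<lambda>k. c * u k) v = c * model_form m u v"
  "model_form m u (\<lambda>k. c * v k) = c * model_form m u v"
  "model_form m (\<lambda>k. u k + u' k) v = model_form m u v + model_form m u' v"
  "model_form m u (\<lambda>k. v k + v' k) = model_form m u v + model_form m u v'"
  "model_form m u (\<lambda>k. v k - v' k) = model_form m u v - model_form m u v'"
  by (auto simp: model_form_def sum_distrib_left algebra_simps sum.distrib sum_subtractf)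

lemma galilei_model_prod5: "(\<And>a b c t v. (y::(complex \<times> complex \<times> complex) \<times> complex \<times> (complex^'n)) = ((a,b,c),t,v) \<Longrightarrow> Q) \<Longrightarrow> Q"
  by (metis prod.exhaust)

lemma galilei_model_lie: "complex_lie_algebra model_scale model_bracket"
proof -
  interpret vector_space model_scale by (rule galilei_model_vs)
  interpret vector_space_pair model_scale model_scale ..
  show ?thesis
  proof (unfold_locales, goal_cases)
    case (1 y x w) then show ?case
      by (cases x; cases w; cases y) (simp add: model_bracket_def galilei_model_C_lin galilei_model_form_lin galilei_model_act_scm galilei_model_V_lin, simp add: model_sl2_bracket_def algebra_simps split: prod.splits)
  next
    case (2 y c x) then show ?case
      by (cases x rule: galilei_model_prod5; cases y rule: galilei_model_prod5) (simp add: model_bracket_def model_scale_def galilei_model_C_lin galilei_model_form_lin galilei_model_act_scm galilei_model_V_lin model_sl2_bracket_def vector_ssub_ldistrib algebra_simps)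
  next
    case (3 y x w) then show ?case
      by (cases x; cases w; cases y) (simp add: model_bracket_def galilei_model_C_lin galilei_model_form_lin galilei_model_act_scm galilei_model_V_lin, simp add: model_sl2_bracket_def algebra_simps split: prod.splits)
  next
    case (4 y c x) then show ?case
      by (cases x rule: galilei_model_prod5; cases y rule: galilei_model_prod5) (simp add: model_bracket_def model_scale_def galilei_model_C_lin galilei_model_form_lin galilei_model_act_scm galilei_model_V_lin model_sl2_bracket_def vector_ssub_ldistrib algebra_simps)
  next
    case (5 x) have "model_form m u u = 0" for u using galilei_model_form_antisym[OF m, of u u] by (simp add: eq_neg_iff_add_eq_0)
    then show ?case
      by (cases x) (auto simp: model_bracket_def model_sl2_bracket_def zero_prod_def algebra_simps)
  next
    case (6 X Y W)
    obtain x t u y s v w r q where e: "X = (x,t,u)" "Y = (y,s,v)" "W = (w,r,q)"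
      by (cases X; cases Y; cases W)
    have 1: "model_form m (model_coord u) (model_act m y (model_coord q)) = model_form m (model_coord q) (model_act m y (model_coord u)) " for u q y
      using galilei_model_form_antisym[OF m, of "model_coord u" "model_act m y (model_coord q)"] galilei_model_form_invariant[of m "model_coord q" "model_coord u" y, OF galilei_model_C_0 galilei_model_C_0 m] by simp
    have 2: "model_sl2_bracket x (model_sl2_bracket y w) + model_sl2_bracket y (model_sl2_bracket w x) + model_sl2_bracket w (model_sl2_bracket x y) = 0"
      by (cases x; cases y; cases w) (simp add: model_sl2_bracket_def zero_prod_def algebra_simps)
    have 3: "model_act m (model_sl2_bracket x y) u = (\<lambda>k. model_act m x (model_act m y u) k - model_act m y (model_act m x u) k)" for x y u
      by (auto simp: galilei_model_act_sl2)
    show ?case unfolding e 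
      apply (simp add: model_bracket_def galilei_model_C_lin galilei_model_C_act galilei_model_act_scm galilei_model_V_lin galilei_model_form_lin 2 3 zero_prod_def algebra_simps)
      using 2 1 by (simp add: zero_prod_def algebra_simps)
  qed
qed


definition model_delta :: "nat \<Rightarrow> nat \<Rightarrow> complex" where
  "model_delta k = (\<lambda>j. if j = k \<and> k < 2*m then 1 else 0)"

lemma galilei_model_act_D: 
  "model_act m (0,1,0) (model_delta k) = (\<lambda>j. 2 * (galilei_l m - of_nat k) * model_delta k j)"
  "model_act m (1,0,0) (model_delta k) = (\<lambda>j. of_nat k * model_delta (k - 1) j)" if "k < 2*m"
  using that by (cases k; auto simp: model_act_def model_delta_def fun_eq_iff galilei_l_def field_simps)+

lemma galilei_model_act_D3: "k < 2*m \<Longrightarrow> model_act m (0,0,1) (model_delta k) = (\<lambda>j. (2 * galilei_l m - of_nat k) * model_delta (k + 1) j)"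
proof
  fix j assume k: "k < 2*m"
  show "model_act m (0,0,1) (model_delta k) j = (2 * galilei_l m - of_nat k) * model_delta (k + 1) j"
  proof (cases "j = k + 1 \<and> j = 2*m")
    case True then have "(of_nat (k+1) :: complex) = of_nat (2*m)" by metis
    then show ?thesis using True by (auto simp: model_act_def model_delta_def galilei_l_def field_simps)
  qed (use k in \<open>cases j; auto simp: model_act_def model_delta_def galilei_l_def field_simps\<close>)
qed

lemma galilei_model_act_0: "model_act m (0,0,0) u = (\<lambda>k. 0)" "model_act m x (\<lambda>k. 0) = (\<lambda>k. 0)" "model_form m u (\<lambda>k. 0) = 0" "model_form m (\<lambda>k. 0) u = 0"
  "model_vec (\<lambda>k. 0) = 0"
  by (auto simp: model_act_def model_form_def model_vec_def vec_eq_iff split: prod.splits)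

definition model_p :: "nat \<Rightarrow> (complex \<times> complex \<times> complex) \<times> complex \<times> (complex ^ 'n)" where
  "model_p k = ((0,0,0),0, model_vec (model_delta k))"

abbreviation (input) "model_e \<equiv> ((1,0,0),0,0) :: (complex \<times> complex \<times> complex) \<times> complex \<times> (complex ^ 'n)"
abbreviation (input) "model_h \<equiv> ((0,1,0),0,0) :: (complex \<times> complex \<times> complex) \<times> complex \<times> (complex ^ 'n)"
abbreviation (input) "model_f \<equiv> ((0,0,1),0,0) :: (complex \<times> complex \<times> complex) \<times> complex \<times> (complex ^ 'n)"
abbreviation (input) "model_z \<equiv> ((0,0,0),1,0) :: (complex \<times> complex \<times> complex) \<times> complex \<times> (complex ^ 'n)"
abbreviation (input) "model_nth x j \<equiv> (snd (snd x) :: complex ^ 'n) $ g j"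

lemma galilei_model_C_V': "model_coord (model_vec (model_delta k)) = model_delta k"
  by (rule galilei_model_C_V) (auto simp: model_delta_def)

lemma galilei_model_P_nth: "j < 2*m \<Longrightarrow> model_nth (model_p k) j = (if j = k then 1 else 0)"
  using fun_cong[OF galilei_model_C_V'[of k], of j] by (simp add: model_coord_def model_p_def model_delta_def)

lemma galilei_model_scm_app: "model_scale c ((a,b,d), t, v) = ((c * a, c * b, c * d), c * t, c *s v)" by (simp add: model_scale_def)

lemma galilei_model_setb: "set ([e,h,f] @ map p [0..<n] @ [z]) = {e,h,f,z} \<union> p ` {..<n}" by auto

lemma galilei_model_gal: "conformal_galilei model_scale model_bracket m model_e model_h model_f model_p model_z"
proof -
  interpret complex_lie_algebra model_scale model_bracket by (rule galilei_model_lie)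
  let ?B = "set ([model_e,model_h,model_f] @ map model_p [0..<2*m] @ [model_z])"
  have B: "?B = {model_e,model_h,model_f,model_z} \<union> model_p ` {..<2*m}" by (rule galilei_model_setb)
  have P0: "fst (model_p k) = (0,0,0)" "fst (snd (model_p k)) = 0" for k by (auto simp: model_p_def)
  have Pn: "model_p k \<noteq> model_e" "model_p k \<noteq> model_h" "model_p k \<noteq> model_f" "model_p k \<noteq> model_z" for k by (auto simp: model_p_def)
  have inj: "inj_on model_p {..<2*m}"
    by (rule inj_onI) (metis galilei_model_P_nth lessThan_iff zero_neq_one)
  have sub: "subspace {x. fst (fst x) = 0}" "subspace {x. fst (snd (fst x)) = 0}" "subspace {x. snd (snd (fst x)) = 0}"
    "subspace {x. fst (snd x) = 0}" "subspace {x. model_nth x k = 0}" for k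
    by (auto simp: subspace_def model_scale_def zero_prod_def)
  have *: "b \<notin> span (?B - {b})" if "subspace S" "b \<notin> S" "?B - {b} \<subseteq> S" for b S
    using span_minimal[OF that(3,1)] that(2) by blast
  have "b \<notin> span (?B - {b})" if bB: "b \<in> ?B" for b
  proof -
    consider "b = model_e" | "b = model_h" | "b = model_f" | "b = model_z" | k where "k < 2*m" "b = model_p k" 
      using bB[unfolded B] by blast
    then show ?thesis
    proof cases
      case 1 show ?thesis unfolding 1 by (rule *[OF sub(1)]) (auto simp: P0)
    next
      case 2 show ?thesis unfolding 2 by (rule *[OF sub(2)]) (auto simp: P0)
    next
      case 3 show ?thesis unfolding 3 by (rule *[OF sub(3)]) (auto simp: P0)
    next
      case 4 show ?thesis unfolding 4 by (rule *[OF sub(4)]) (auto simp: P0)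
    next
      case (5 k) show ?thesis unfolding 5(2)
      proof (rule *[OF sub(5)[of k]])
        show "model_p k \<notin> {x. model_nth x k = 0}" using 5 by (simp add: galilei_model_P_nth)
        show "?B - {model_p k} \<subseteq> {x. model_nth x k = 0}" unfolding B using 5 by (auto simp: galilei_model_P_nth)
      qed
    qed
  qed
  then have ind: "independent ?B" unfolding dependent_def by blast
  have sp: "x \<in> span ?B" for x
  proof -
    obtain a b c t v where x: "x = ((a,b,c),t,v)" by (cases x rule: galilei_model_prod5)
    have s: "snd (\<Sum>k\<in>A. model_scale (v $ g k) (model_p k)) = (0, \<Sum>k\<in>A. (v $ g k) *s snd (snd (model_p k)))" 
      "fst (\<Sum>k\<in>A. model_scale (v $ g k) (model_p k)) = (0,0,0)" if "finite A" for A
      using that by (induction rule: finite_induct) (auto simp: model_scale_def model_p_def zero_prod_def)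
    have "v = (\<Sum>k<2*m. (v $ g k) *s snd (snd (model_p k)))"
    proof (rule galilei_model_C_eqI, rule ext)
      fix j show "model_coord v j = model_coord (\<Sum>k<2*m. (v $ g k) *s snd (snd (model_p k))) j"
        by (simp add: model_coord_def galilei_model_P_nth if_distrib cong: if_cong)
    qed
    then have "x = model_scale a model_e + model_scale b model_h + model_scale c model_f + model_scale t model_z + (\<Sum>k<2*m. model_scale (v $ g k) (model_p k))"
      by (intro prod_eqI) (auto simp: x s galilei_model_scm_app)
    also have "\<dots> \<in> span ?B"
      unfolding B by (intro span_add span_scale span_sum span_base) auto
    finally show ?thesis .
  qed
  show ?thesis
  proof (unfold_locales, goal_cases)
    case 1 show ?case by (rule m)
  next
    case 2 show ?case using inj Pn Pn[symmetric] by (simp add: distinct_map atLeast0LessThan) blast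
  next
    case 3 show ?case by (rule ind)
  next
    case 4 show ?case using sp by blast
  next
    case 5 show ?case by (simp add: model_bracket_def model_scale_def model_sl2_bracket_def galilei_model_C_lin model_form_def model_vec_def vec_eq_iff model_act_def)
  next
    case 6 show ?case by (simp add: model_bracket_def model_scale_def model_sl2_bracket_def galilei_model_C_lin model_form_def model_vec_def vec_eq_iff model_act_def)
  next
    case 7 show ?case by (simp add: model_bracket_def model_scale_def model_sl2_bracket_def galilei_model_C_lin model_form_def model_vec_def vec_eq_iff model_act_def)
  next
    case (8 k) then have "k < 2*m" using m by auto
    then show ?case by (simp add: model_bracket_def model_sl2_bracket_def model_p_def galilei_model_scm_app galilei_model_C_lin galilei_model_C_V' galilei_model_act_D galilei_model_act_0 galilei_model_V_lin del: of_nat_add of_nat_Suc of_nat_diff)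
  next
    case (9 k) then have "k < 2*m" using m by auto
    then show ?case by (simp add: model_bracket_def model_sl2_bracket_def model_p_def galilei_model_scm_app galilei_model_C_lin galilei_model_C_V' galilei_model_act_D galilei_model_act_0 galilei_model_V_lin del: of_nat_add of_nat_Suc of_nat_diff)
  next
    case (10 k) then have "k < 2*m" using m by auto
    then show ?case by (simp add: model_bracket_def model_sl2_bracket_def model_p_def galilei_model_scm_app galilei_model_C_lin galilei_model_C_V' galilei_model_act_D3 galilei_model_act_0 galilei_model_V_lin del: of_nat_add of_nat_Suc of_nat_diff)
  next
    case (11 x) then show ?case by (cases x rule: galilei_model_prod5) (simp add: model_bracket_def model_sl2_bracket_def galilei_model_C_lin model_form_def model_vec_def vec_eq_iff model_act_def zero_prod_def)
  next
    case (12 k k')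
    have "model_form m (model_delta k) (model_delta k')
       = (\<Sum>j<2*m. if j = k then model_coeff m k * (if k + k' = 2*m-1 then 1 else 0) else 0)"
      unfolding model_form_def model_delta_def using 12 m by (intro sum.cong) auto
    also have "\<dots> = (if k + k' = 2*m-1 then model_coeff m k else 0)" using 12 m by auto
    finally show ?case
      by (simp add: model_bracket_def galilei_model_scm_app model_sl2_bracket_def model_p_def galilei_model_C_V' galilei_model_act_0 model_coeff_def zero_prod_def)
  qed
qed

end

lemma conformal_galilei_exists:
  assumes "m \<ge> 1" "CARD('n::finite) = 2*m"
  shows "\<exists>scl bracket e h f p (z :: (complex \<times> complex \<times> complex) \<times> complex \<times> (complex ^ 'n)). conformal_galilei scl bracket m e h f p z"
proof -
  obtain g where "bij_betw g {..<2*m} (UNIV :: 'n set)"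
    using assms ex_bij_betw_nat_finite[of "UNIV :: 'n set"] by (auto simp: atLeast0LessThan)
  from galilei_model_gal[OF assms(1) this] show ?thesis by blast
qed

end

theory Submission
  imports Defs
begin

text \<open>
  Everything rests on the fact that \<open>ad h\<close> acts diagonally on the given basis, with weight \<open>2\<close> on
  \<open>e\<close>, \<open>-2\<close> on \<open>f\<close>, \<open>0\<close> on \<open>h\<close> and \<open>z\<close>, and \<open>2l - 2k\<close> on \<open>p k\<close>. As \<open>2l\<close> is odd, the weights
  on the \<open>p k\<close> are odd, so they never meet the others, and all weight spaces except the zero one
  are lines (\<open>h_weight_cases\<close>).

  Let \<open>D\<close> be a derivation. Since \<open>ad h\<close> is diagonalizable, its range and its kernel, spanned by
  \<open>h\<close> and \<open>z\<close>, together span the algebra; subtracting an inner derivation from \<open>D\<close> therefore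
  achieves that \<open>D h\<close> is a combination of \<open>h\<close> and \<open>z\<close>. Applying \<open>D\<close> to the brackets among \<open>e\<close>,
  \<open>h\<close>, \<open>f\<close> then forces \<open>D h = 0\<close>, \<open>D e = a e\<close> and \<open>D f = -a f\<close>, which is \<open>ad ((a/2) h)\<close> on these
  three vectors. So \<open>D\<close> agrees with an inner derivation on the copy of \<open>sl\<^sub>2\<close>
  (\<open>derivation_eq_ad_on_sl2\<close>), and what remains is a derivation that kills it. Such a
  derivation commutes with \<open>ad h\<close> and \<open>ad f\<close>: the first makes \<open>p 0\<close> an eigenvector, the second
  carries the eigenvalue \<open>c\<close> along the string \<open>p 0, p 1, \<dots>\<close>, and the nonzero bracket of the two
  ends of the string gives the eigenvalue \<open>2c\<close> on \<open>z\<close>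
  (\<open>derivation_killing_sl2_is_scalar_on_p\<close>). Hence it is \<open>2c \<delta>\<close>.

  Conversely \<open>\<delta>\<close> is a derivation because it is multiplication by the degree for a grading of the
  Lie algebra with degrees \<open>0\<close>, \<open>1/2\<close>, \<open>1\<close> (\<open>half_grading_is_derivation\<close>), and no nonzero
  multiple of it is inner because it does not kill the central element \<open>z\<close>.
\<close>

section \<open>Linear maps that are diagonal in a basis\<close>

lemma (in vector_space) diagonal_map_representation:
  assumes T: "Vector_Spaces.linear scale scale T"
    and B: "independent B" "span B = UNIV"
    and diag: "\<And>b. b \<in> B \<Longrightarrow> \<exists>c. T b = scale c b"
    and b: "b \<in> B" "T b = scale lam b"
  shows "representation B (T x) b = lam * representation B x b"
proof -
  interpret vector_space_pair scale scale ..
  obtain \<mu> where \<mu>: "\<And>b. b \<in> B \<Longrightarrow> T b = scale (\<mu> b) b"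
    using diag by metis
  have inB: "y \<in> span B" for y using B by simp
  have rep: "representation B (T y) b = \<mu> b * representation B y b" for y b
    using inB[of y]
  proof (induction y rule: span_induct_alt)
    case base
    then show ?case by (simp add: linear_0[OF T] representation_zero)
  next
    case (step c b' y)
    then show ?case
      using B inB
      by (simp add: linear_add[OF T] linear_scale[OF T] representation_add representation_scale
          \<mu> representation_basis algebra_simps)
  qed
  have "scale (\<mu> b) b = scale lam b" using \<mu> b by metis
  moreover have "b \<noteq> 0" using B(1) b(1) dependent_zero by blast
  ultimately have "\<mu> b = lam" by simp
  then show ?thesis using rep by simp
qed

text \<open>By the previous lemma, a coordinate of an eigenvector can only be nonzero at basis vectors
  with the same eigenvalue.\<close>

lemma (in vector_space) eigenvector_in_span_of_eigenbasis:
  assumes T: "Vector_Spaces.linear scale scale T"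
    and B: "independent B" "span B = UNIV"
    and diag: "\<And>b. b \<in> B \<Longrightarrow> \<exists>c. T b = scale c b"
    and x: "T x = scale lam x"
  shows "x \<in> span {b \<in> B. T b = scale lam b}"
proof -
  have inB: "y \<in> span B" for y using B by simp
  have "b \<in> {b \<in> B. T b = scale lam b}" if nz: "representation B x b \<noteq> 0" for b
  proof -
    have b: "b \<in> B" using nz by (rule representation_ne_zero)
    then obtain c where c: "T b = scale c b" using diag by blast
    have "representation B (T x) b = lam * representation B x b"
      using B inB by (simp add: x representation_scale)
    then have "c * representation B x b = lam * representation B x b"
      using diagonal_map_representation[OF T B diag b c, of x] by metis
    then have "c = lam" using nz by (metis mult_cancel_right)
    then show ?thesis using b c by simp
  qed
  then have "(\<Sum>b | representation B x b \<noteq> 0. scale (representation B x b) b)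
      \<in> span {b \<in> B. T b = scale lam b}"
    by (intro span_sum span_scale span_base) blast
  then show ?thesis
    using sum_nonzero_representation_eq[OF B(1) inB, of x] by simp
qed

text \<open>A basis vector with nonzero eigenvalue lies in the range, and the remaining ones span the
  kernel. This is what allows a derivation to be corrected by an inner one.\<close>

lemma (in vector_space) diagonal_map_range_mod_kernel:
  assumes T: "Vector_Spaces.linear scale scale T"
    and B: "span B = UNIV"
    and diag: "\<And>b. b \<in> B \<Longrightarrow> \<exists>c. T b = scale c b"
  shows "\<exists>y. x - T y \<in> span {b \<in> B. T b = 0}"
proof -
  interpret vector_space_pair scale scale ..
  have "x \<in> span B" using B by simp
  then show ?thesis
  proof (induction x rule: span_induct_alt)
    case base
    show ?case by (intro exI[of _ 0]) (simp add: linear_0[OF T] span_zero)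
  next
    case (step c b x)
    then obtain y where y: "x - T y \<in> span {b \<in> B. T b = 0}" by blast
    obtain d where d: "T b = scale d b" using diag step by blast
    show ?case
    proof (cases "d = 0")
      case True
      then have "scale c b + (x - T y) \<in> span {b \<in> B. T b = 0}"
        using y step(1) d by (intro span_add[OF _ y] span_scale span_base) simp
      then show ?thesis by (intro exI[of _ y]) (simp add: algebra_simps)
    next
      case False
      then have "scale c b + x - T (scale (c / d) b + y) = x - T y"
        by (simp add: linear_add[OF T] linear_scale[OF T] d)
      then show ?thesis using y by metis
    qed
  qed
qed

section \<open>Derivations of a Lie algebra\<close>

context complex_lie_algebra
begin

interpretation vector_space_pair scl scl ..

lemmas bracket_add_left = linear_add[OF linear_bracket_left]
  and bracket_add_right = linear_add[OF linear_bracket_right]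
  and bracket_diff_left = linear_diff[OF linear_bracket_left]
  and bracket_diff_right = linear_diff[OF linear_bracket_right]
  and bracket_scale_left = linear_scale[OF linear_bracket_left]
  and bracket_scale_right = linear_scale[OF linear_bracket_right]
  and bracket_zero_left = linear_0[OF linear_bracket_left]
  and bracket_zero_right = linear_0[OF linear_bracket_right]
  and bracket_minus_left = linear_neg[OF linear_bracket_left]
  and bracket_minus_right = linear_neg[OF linear_bracket_right]

lemma bracket_antisym: "bracket y x = - bracket x y"
proof -
  have "bracket (x + y) (x + y) = bracket x y + bracket y x"
    unfolding bracket_add_left bracket_add_right by (simp add: bracket_self)
  then show ?thesis by (simp add: bracket_self eq_neg_iff_add_eq_0 add.commute)
qed

text \<open>The Leibniz rule for \<open>ad a\<close> is the Jacobi identity, rearranged by antisymmetry.\<close>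

lemma ad_in_derivations: "ad bracket a \<in> derivations scl bracket"
proof -
  have "bracket a (bracket x y) = bracket (bracket a x) y + bracket x (bracket a y)" for x y
    using jacobi[of a x y] bracket_antisym[of y "bracket a x"] bracket_antisym[of y a]
    by (simp add: bracket_minus_right add_eq_0_iff2) (simp add: algebra_simps)
  then show ?thesis
    by (simp add: derivations_def ad_def linear_bracket_right)
qed

lemma derivations_add:
  assumes "D \<in> derivations scl bracket" "D' \<in> derivations scl bracket"
  shows "(\<lambda>x. D x + D' x) \<in> derivations scl bracket"
  using assms
  by (simp add: derivations_def linear_compose_add bracket_add_left bracket_add_right)

lemma derivations_scale:
  assumes "D \<in> derivations scl bracket"
  shows "(\<lambda>x. scl c (D x)) \<in> derivations scl bracket"
  using assms
  by (simp add: derivations_def linear_compose_scale_right bracket_scale_left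
      bracket_scale_right scale_right_distrib)

lemma derivations_diff:
  assumes "D \<in> derivations scl bracket" "D' \<in> derivations scl bracket"
  shows "(\<lambda>x. D x - D' x) \<in> derivations scl bracket"
  using assms
  by (simp add: derivations_def linear_compose_sub bracket_diff_left bracket_diff_right)

lemma derivation_if_leibniz_on_spanning_set:
  assumes D: "Vector_Spaces.linear scl scl D"
    and B: "span B = UNIV"
    and leibniz: "\<And>x y. x \<in> B \<Longrightarrow> y \<in> B \<Longrightarrow> D (bracket x y) = bracket (D x) y + bracket x (D y)"
  shows "D \<in> derivations scl bracket"
proof -
  let ?Q = "\<lambda>x y. D (bracket x y) = bracket (D x) y + bracket x (D y)"
  note lin = linear_0[OF D] linear_add[OF D] linear_scale[OF D] bracket_add_left bracket_add_right
    bracket_scale_left bracket_scale_right bracket_zero_left bracket_zero_right scale_right_distrib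
  have left: "?Q x y" if "y \<in> B" for x y
  proof -
    have "x \<in> span B" using B by simp
    then show ?thesis
      by (induction x rule: span_induct_alt) (simp_all add: lin leibniz that)
  qed
  have "?Q x y" for x y
  proof -
    have "y \<in> span B" using B by simp
    then show ?thesis
      by (induction y rule: span_induct_alt) (simp_all add: lin left)
  qed
  then show ?thesis using D by (simp add: derivations_def)
qed

end

section \<open>Weights of the conformal Galilei algebra\<close>

context conformal_galilei
begin

interpretation vector_space_pair scl scl ..

definition galilei_basis :: "'a set" where
  "galilei_basis = {e, h, f, z} \<union> p ` {..2*m-1}"

lemma galilei_basis_eq: "set ([e, h, f] @ map p [0..<2*m] @ [z]) = galilei_basis"
proof -
  have "{0..<2*m} = {..2*m-1}" using m_pos by auto
  then show ?thesis unfolding galilei_basis_def by auto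
qed

lemma galilei_basis_independent: "independent galilei_basis"
  using basis_independent unfolding galilei_basis_eq .

lemma galilei_basis_span: "span galilei_basis = UNIV"
  using basis_span unfolding galilei_basis_eq .

lemma galilei_basis_nonzero: "x \<in> galilei_basis \<Longrightarrow> x \<noteq> 0"
  using galilei_basis_independent dependent_zero by blast

lemma generators_nonzero:
  "e \<noteq> 0" "h \<noteq> 0" "f \<noteq> 0" "z \<noteq> 0" "k \<le> 2*m-1 \<Longrightarrow> p k \<noteq> 0"
  by (auto intro!: galilei_basis_nonzero simp: galilei_basis_def)

lemma galilei_basis_cases:
  assumes "x \<in> galilei_basis"
  obtains "x = e" | "x = h" | "x = f" | "x = z" | k where "k \<le> 2*m-1" "x = p k"
  using assms unfolding galilei_basis_def by blast

text \<open>The weights are written as integers so that they can be told apart by parity.\<close>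

lemma h_weight_eq:
  "2 * (galilei_l m - of_nat k) = of_int (2 * int m - 1 - 2 * int k)"
  by (simp add: galilei_l_def algebra_simps)

lemma bracket_h_z: "bracket h z = 0"
  using bracket_antisym[of h z] bracket_z by simp

lemma bracket_z_right: "bracket x z = 0"
  using bracket_antisym[of x z] bracket_z by simp

lemma bracket_h_p_int:
  "k \<le> 2*m-1 \<Longrightarrow> bracket h (p k) = scl (of_int (2 * int m - 1 - 2 * int k)) (p k)"
  using bracket_h_p h_weight_eq by simp

lemma ad_h_diagonal:
  assumes "b \<in> galilei_basis"
  shows "\<exists>c. bracket h b = scl c b"
  using assms
proof (cases rule: galilei_basis_cases)
  case 2
  show ?thesis unfolding 2 by (intro exI[of _ 0]) (simp add: bracket_self)
next
  case 4
  show ?thesis unfolding 4 by (intro exI[of _ 0]) (simp add: bracket_h_z)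
next
  case 3
  show ?thesis unfolding 3 using bracket_h_f by blast
qed (auto simp: bracket_h_e bracket_h_p)

lemmas h_weight_space = eigenvector_in_span_of_eigenbasis[OF linear_bracket_right
    galilei_basis_independent galilei_basis_span ad_h_diagonal]

lemma h_weight_cases:
  assumes b: "b \<in> galilei_basis" and wt: "bracket h b = scl (of_int w) b"
  shows "w = 2 \<and> b = e \<or> w = -2 \<and> b = f \<or> w = 0 \<and> b \<in> {h, z}
    \<or> odd w \<and> (\<exists>k\<le>2*m-1. w = 2 * int m - 1 - 2 * int k \<and> b = p k)"
proof -
  have unique: "w = v" if "bracket h b = scl (of_int v) b" for v
  proof -
    have "scl (of_int w) b = scl (of_int v) b" using trans[OF wt[symmetric] that] .
    then have "(of_int w :: complex) = of_int v"
      by (rule scale_right_imp_eq[OF galilei_basis_nonzero[OF b]])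
    then show ?thesis by simp
  qed
  show ?thesis
    using b
  proof (cases rule: galilei_basis_cases)
    case 1
    then show ?thesis using unique[of 2] by (simp add: bracket_h_e)
  next
    case 2
    then show ?thesis using unique[of 0] by (simp add: bracket_self)
  next
    case 3
    then show ?thesis using unique[of "-2"] by (simp add: bracket_h_f)
  next
    case 4
    then show ?thesis using unique[of 0] by (simp add: bracket_h_z)
  next
    case (5 k)
    then have "w = 2 * int m - 1 - 2 * int k" using unique bracket_h_p_int by blast
    then show ?thesis using 5 by auto
  qed
qed

lemma weight_space_two:
  assumes "bracket h x = scl 2 x" shows "\<exists>c. x = scl c e"
proof -
  have "b = e" if "b \<in> galilei_basis" "bracket h b = scl 2 b" for b
    using h_weight_cases[of b 2] that by auto
  then have "{b \<in> galilei_basis. bracket h b = scl 2 b} \<subseteq> {e}" by blast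
  then have "x \<in> span {e}" using h_weight_space[OF _ assms] span_mono by blast
  then show ?thesis by (auto simp: span_singleton)
qed

lemma weight_space_minus_two:
  assumes "bracket h x = scl (-2) x" shows "\<exists>c. x = scl c f"
proof -
  have "b = f" if "b \<in> galilei_basis" "bracket h b = scl (-2) b" for b
    using h_weight_cases[of b "-2"] that by auto
  then have "{b \<in> galilei_basis. bracket h b = scl (-2) b} \<subseteq> {f}" by blast
  then have "x \<in> span {f}" using h_weight_space[OF _ assms] span_mono by blast
  then show ?thesis by (auto simp: span_singleton)
qed

lemma weight_space_p:
  assumes k: "k \<le> 2*m-1" and x: "bracket h x = scl (2 * (galilei_l m - of_nat k)) x"
  shows "\<exists>c. x = scl c (p k)"
proof -
  have "b = p k"
    if b: "b \<in> galilei_basis" "bracket h b = scl (2 * (galilei_l m - of_nat k)) b" for b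
  proof -
    have "bracket h b = scl (of_int (2 * int m - 1 - 2 * int k)) b"
      using b(2) by (simp only: h_weight_eq)
    moreover have "2 * int m - 1 - 2 * int k \<noteq> 2" "2 * int m - 1 - 2 * int k \<noteq> -2"
      "2 * int m - 1 - 2 * int k \<noteq> 0"
      by presburger+
    ultimately obtain i where "2 * int m - 1 - 2 * int k = 2 * int m - 1 - 2 * int i" "b = p i"
      using h_weight_cases[OF b(1)] by blast
    then show ?thesis by simp
  qed
  then have "{b \<in> galilei_basis. bracket h b = scl (2 * (galilei_l m - of_nat k)) b} \<subseteq> {p k}"
    by blast
  then have "x \<in> span {p k}" using h_weight_space[OF _ x] span_mono by blast
  then show ?thesis by (auto simp: span_singleton)
qed

lemma ad_h_range_mod_centralizer:
  "\<exists>y c d. x = bracket h y + scl c h + scl d z"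
proof -
  obtain y where y: "x - bracket h y \<in> span {b \<in> galilei_basis. bracket h b = 0}"
    using diagonal_map_range_mod_kernel[OF linear_bracket_right galilei_basis_span ad_h_diagonal]
    by blast
  have "b \<in> {h, z}" if "b \<in> galilei_basis" "bracket h b = 0" for b
    using h_weight_cases[of b 0] that by auto
  then have "{b \<in> galilei_basis. bracket h b = 0} \<subseteq> {h, z}" by blast
  then have "x - bracket h y \<in> span {h, z}" using y span_mono by blast
  then obtain c d where "x - bracket h y - scl c h = scl d z"
    by (auto simp: span_insert span_singleton)
  then have "x = bracket h y + scl c h + scl d z" by (simp add: diff_eq_eq ac_simps)
  then show ?thesis by blast
qed

section \<open>Derivations of the conformal Galilei algebra\<close>

text \<open>After subtraction of an inner derivation, \<open>D h = c h + d z\<close>. Here \<open>c = 0\<close>, because a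
  diagonal map minus an eigenvalue cannot have a nonzero multiple of the eigenvector \<open>e\<close> in its
  range; and \<open>d = 0\<close>, because \<open>h = [e, f]\<close> is sent to a multiple of \<open>h\<close>.\<close>

lemma derivation_eq_ad_on_sl2:
  assumes D: "D \<in> derivations scl bracket"
  shows "\<exists>a. D e = bracket a e \<and> D h = bracket a h \<and> D f = bracket a f"
proof -
  obtain y c d where Dh: "D h = bracket h y + scl c h + scl d z"
    using ad_h_range_mod_centralizer by blast
  define D' where "D' x = D x + bracket y x" for x
  have D': "D' \<in> derivations scl bracket"
    using derivations_add[OF D ad_in_derivations[of y]] by (simp add: D'_def[abs_def] ad_def)
  have lin: "Vector_Spaces.linear scl scl D'"
    and leib: "\<And>x y. D' (bracket x y) = bracket (D' x) y + bracket x (D' y)"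
    using D' by (auto simp: derivations_def)
  have h: "D' h = scl c h + scl d z"
    using bracket_antisym[of y h] by (simp add: D'_def Dh)
  have hD'e: "bracket h (D' e) = scl 2 (D' e) - scl (2 * c) e"
  proof -
    have "scl 2 (D' e) = scl (2 * c) e + bracket h (D' e)"
      using leib[of h e]
      by (simp add: bracket_h_e linear_scale[OF lin] h bracket_add_left bracket_scale_left
          bracket_z mult.commute)
    then show ?thesis by (simp add: algebra_simps)
  qed
  \<comment> \<open>Compare the coordinates at \<open>e\<close>: those of \<open>[h, D' e]\<close> and \<open>2 D' e\<close> coincide.\<close>
  have "c = 0"
  proof -
    let ?r = "\<lambda>x. representation galilei_basis x e"
    have "e \<in> galilei_basis" by (simp add: galilei_basis_def)
    then have "?r (bracket h (D' e)) = 2 * ?r (D' e)"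
      by (intro diagonal_map_representation[OF linear_bracket_right galilei_basis_independent
            galilei_basis_span] ad_h_diagonal bracket_h_e)
    moreover have "?r (bracket h (D' e)) = 2 * ?r (D' e) - 2 * c"
      using \<open>e \<in> galilei_basis\<close> galilei_basis_independent
      by (simp add: hD'e representation_diff representation_scale galilei_basis_span
          representation_basis)
    ultimately show ?thesis by simp
  qed
  then have "bracket h (D' e) = scl 2 (D' e)" using hD'e by simp
  then obtain a where a: "D' e = scl a e" using weight_space_two by blast
  have "bracket h (D' f) = scl (-2) (D' f)"
    using leib[of h f] \<open>c = 0\<close>
    by (simp add: bracket_h_f linear_scale[OF lin] linear_neg[OF lin] h bracket_scale_left bracket_z)
  then obtain b where b: "D' f = scl b f" using weight_space_minus_two by blast
  have D'h: "D' h = scl (a + b) h"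
    using leib[of e f]
    by (simp add: bracket_e_f a b bracket_scale_left bracket_scale_right scale_left_distrib)
  \<comment> \<open>The bracket with \<open>e\<close> distinguishes multiples of \<open>h\<close> from those of the central \<open>z\<close>.\<close>
  have "bracket (scl (a + b) h) e = bracket (scl d z) e"
    using D'h h \<open>c = 0\<close> by simp
  then have "(a + b) * 2 = 0"
    using generators_nonzero(1) by (simp add: bracket_scale_left bracket_z bracket_h_e)
  then have ab: "a + b = 0" by (metis mult_eq_0_iff zero_neq_numeral)
  let ?a = "scl (a / 2) h - y"
  have D: "D x = D' x - bracket y x" for x by (simp add: D'_def)
  have "D e = bracket ?a e"
    by (simp add: D a bracket_diff_left bracket_scale_left bracket_h_e)
  moreover have "D h = bracket ?a h"
    by (simp add: D D'h ab bracket_diff_left bracket_scale_left bracket_self)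
  moreover have "D f = bracket ?a f"
    using ab by (simp add: D b bracket_diff_left bracket_scale_left bracket_h_f bracket_minus_left add_eq_0_iff2)
  ultimately show ?thesis by blast
qed

text \<open>By Schur's lemma one expects a scalar on the \<open>p k\<close>, as they span an irreducible module over
  \<open>sl\<^sub>2\<close>. The argument is direct: \<open>ad h\<close> fixes the line of \<open>p 0\<close>, and \<open>ad f\<close> moves along the
  string with coefficients \<open>2l - k\<close> that vanish only at its end.\<close>

lemma derivation_killing_sl2_is_scalar_on_p:
  assumes D: "D \<in> derivations scl bracket"
    and D0: "D e = 0" "D h = 0" "D f = 0"
  shows "\<exists>c. (\<forall>k\<le>2*m-1. D (p k) = scl c (p k)) \<and> D z = scl (2 * c) z"
proof -
  have lin: "Vector_Spaces.linear scl scl D"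
    and leib: "\<And>x y. D (bracket x y) = bracket (D x) y + bracket x (D y)"
    using D by (auto simp: derivations_def)
  have "bracket h (D (p 0)) = scl (2 * (galilei_l m - of_nat 0)) (D (p 0))"
    using leib[of h "p 0"] bracket_h_p[of 0]
    by (simp add: D0 bracket_zero_left linear_scale[OF lin])
  then obtain c where c: "D (p 0) = scl c (p 0)" using weight_space_p[of 0] by auto
  have Dp: "D (p k) = scl c (p k)" if "k \<le> 2*m-1" for k
    using that
  proof (induction k)
    case 0
    show ?case by (rule c)
  next
    case (Suc k)
    let ?n = "2 * galilei_l m - of_nat k"
    have "?n = of_nat (2*m-1-k)"
      using Suc.prems by (simp add: galilei_l_def of_nat_diff)
    then have "?n \<noteq> 0" using Suc.prems by (simp only: of_nat_eq_0_iff)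
    have f: "bracket f (p k) = scl ?n (p (Suc k))"
      using bracket_f_p[of k] Suc.prems by simp
    have "scl ?n (D (p (Suc k))) = D (bracket f (p k))"
      by (simp only: f linear_scale[OF lin])
    also have "\<dots> = scl c (bracket f (p k))"
      using Suc by (simp add: leib D0 bracket_zero_left bracket_scale_right)
    also have "\<dots> = scl ?n (scl c (p (Suc k)))"
      by (simp only: f scale_left_commute)
    finally show ?case
      using \<open>?n \<noteq> 0\<close> by (simp only: scale_cancel_left simp_thms)
  qed
  define n :: complex where "n = (-1) ^ (0 + m) * fact 0 * fact (2*m-1-0)"
  have "n \<noteq> 0" by (simp add: n_def)
  have pp: "bracket (p 0) (p (2*m-1)) = scl n z"
    using bracket_p_p[of 0 "2*m-1"] by (simp add: n_def)
  have "scl n (D z) = D (bracket (p 0) (p (2*m-1)))"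
    by (simp only: pp linear_scale[OF lin])
  also have "\<dots> = scl (2 * c) (bracket (p 0) (p (2*m-1)))"
    by (simp add: leib Dp bracket_scale_left bracket_scale_right flip: scale_left_distrib)
  also have "\<dots> = scl n (scl (2 * c) z)"
    by (simp only: pp scale_left_commute)
  finally have "D z = scl (2 * c) z" using \<open>n \<noteq> 0\<close> by (simp only: scale_cancel_left simp_thms)
  then show ?thesis using Dp by blast
qed

text \<open>The algebra is graded with \<open>e, h, f\<close> in degree \<open>0\<close>, the \<open>p k\<close> in degree \<open>1/2\<close> and \<open>z\<close> in
  degree \<open>1\<close>, and \<open>\<delta>\<close> multiplies by the degree. The Leibniz rule on basis vectors expresses that
  brackets add degrees.\<close>

lemma half_grading_is_derivation:
  assumes lin: "Vector_Spaces.linear scl scl \<delta>"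
    and \<delta>: "\<delta> h = 0" "\<delta> e = 0" "\<delta> f = 0" "\<delta> z = z"
    and \<delta>p: "\<And>i. i \<le> 2*m-1 \<Longrightarrow> \<delta> (p i) = scl (1/2) (p i)"
  shows "\<delta> \<in> derivations scl bracket"
proof (rule derivation_if_leibniz_on_spanning_set[OF lin galilei_basis_span])
  let ?Q = "\<lambda>x y. \<delta> (bracket x y) = bracket (\<delta> x) y + bracket x (\<delta> y)"
  have sym: "?Q y x" if "?Q x y" for x y
    using that
    by (simp add: bracket_antisym[of y x] bracket_antisym[of "\<delta> y" x] bracket_antisym[of y "\<delta> x"]
        linear_neg[OF lin])
  note simps = \<delta> bracket_self bracket_h_e bracket_h_f bracket_e_f bracket_z bracket_z_right
    bracket_antisym[of e h] bracket_antisym[of f h] bracket_antisym[of f e]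
    bracket_zero_left bracket_zero_right linear_0[OF lin] linear_neg[OF lin] linear_scale[OF lin]
  have f: "?Q f (p k)" if k: "k \<le> 2*m-1" for k
    \<comment> \<open>At the end of the string the bracket is a zero multiple of \<open>p (2 * m)\<close>, on which nothing is
      known about \<open>\<delta>\<close>.\<close>
  proof (cases "k = 2*m-1")
    case True
    then have "2 * galilei_l m - of_nat k = 0"
      using m_pos by (simp add: galilei_l_def of_nat_diff)
    then have "bracket f (p k) = 0" using bracket_f_p[OF k] by simp
    then show ?thesis by (simp add: simps \<delta>p[OF k] bracket_scale_right)
  next
    case False
    then show ?thesis using k \<delta>p[of "k + 1"]
      by (simp add: simps \<delta>p bracket_f_p bracket_scale_right mult.commute)
  qed
  have p: "?Q x (p k)" if x: "x \<in> galilei_basis" and k: "k \<le> 2*m-1" for x k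
    using x
  proof (cases rule: galilei_basis_cases)
    case 1
    then show ?thesis using k \<delta>p[of "k - 1"]
      by (simp add: simps \<delta>p bracket_e_p bracket_scale_right mult.commute)
  next
    case 2
    then show ?thesis using k
      by (simp add: simps \<delta>p bracket_h_p bracket_scale_right mult.commute)
  next
    case 3
    then show ?thesis using f k by simp
  next
    case 4
    then show ?thesis by (simp add: simps)
  next
    case (5 i)
    have "\<delta> (bracket (p i) (p k)) = bracket (p i) (p k)"
      using 5 k by (simp add: bracket_p_p simps)
    moreover have "bracket (p i) (p k) = scl (1/2) (bracket (p i) (p k)) + scl (1/2) (bracket (p i) (p k))"
      by (simp flip: scale_left_distrib)
    ultimately show ?thesis
      using 5 k by (simp add: \<delta>p bracket_scale_left bracket_scale_right)
  qed
  fix x y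
  assume x: "x \<in> galilei_basis" and y: "y \<in> galilei_basis"
  show "?Q x y"
  proof (cases "x \<in> p ` {..2*m-1} \<or> y \<in> p ` {..2*m-1}")
    case True
    then show ?thesis using p[OF x] sym[OF p[OF y]] by blast
  next
    case False
    then have "x \<in> {e, h, f, z}" "y \<in> {e, h, f, z}"
      using x y by (auto simp: galilei_basis_def)
    then show ?thesis by (auto simp: simps)
  qed
qed

end

section \<open>The decomposition of the derivations\<close>

theorem lemma2p2:
  fixes scl :: "complex \<Rightarrow> 'a::ab_group_add \<Rightarrow> 'a"
    and bracket :: "'a \<Rightarrow> 'a \<Rightarrow> 'a"
    and m :: nat and e h f z :: 'a and p :: "nat \<Rightarrow> 'a"
    and \<delta> :: "'a \<Rightarrow> 'a"
  assumes "conformal_galilei scl bracket m e h f p z"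
    and "Vector_Spaces.linear scl scl \<delta>"
    and "\<delta> h = 0" and "\<delta> e = 0" and "\<delta> f = 0" and "\<delta> z = z"
    and "\<And>i. i \<le> 2*m-1 \<Longrightarrow> \<delta> (p i) = scl (1/2) (p i)"
  shows "is_direct_sum (derivations scl bracket)
           {\<lambda>x. scl c (\<delta> x) | c. c \<in> UNIV}
           (range (ad bracket))"
proof -
  interpret conformal_galilei scl bracket m e h f p z by fact
  interpret vector_space_pair scl scl ..
  let ?C = "{\<lambda>x. scl c (\<delta> x) | c. c \<in> UNIV}"
  note lin\<delta> = assms(2) and \<delta> = assms(3-6) and \<delta>p = assms(7)
  have \<delta>_der: "\<delta> \<in> derivations scl bracket"
    by (rule half_grading_is_derivation[OF assms(2-7)])
  have decompose: "\<exists>c a. D = (\<lambda>x. scl c (\<delta> x) + ad bracket a x)"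
    if D: "D \<in> derivations scl bracket" for D
  proof -
    obtain a where a: "D e = bracket a e" "D h = bracket a h" "D f = bracket a f"
      using derivation_eq_ad_on_sl2[OF D] by blast
    define D' where "D' x = D x - ad bracket a x" for x
    have D': "D' \<in> derivations scl bracket"
      using derivations_diff[OF D ad_in_derivations[of a]] by (simp add: D'_def[abs_def])
    have D'0: "D' e = 0" "D' h = 0" "D' f = 0"
      by (simp_all add: D'_def ad_def a)
    obtain c where c: "\<And>k. k \<le> 2*m-1 \<Longrightarrow> D' (p k) = scl c (p k)" "D' z = scl (2 * c) z"
      using derivation_killing_sl2_is_scalar_on_p[OF D' D'0] by blast
    have "D' x = scl (2 * c) (\<delta> x)" for x
    proof (rule linear_eq_on[where g = "\<lambda>x. scl (2 * c) (\<delta> x)"])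
      show "Vector_Spaces.linear scl scl D'" using D' by (simp add: derivations_def)
      show "Vector_Spaces.linear scl scl (\<lambda>x. scl (2 * c) (\<delta> x))"
        using lin\<delta> by (rule linear_compose_scale_right)
      show "x \<in> span galilei_basis" by (simp add: galilei_basis_span)
      show "D' b = scl (2 * c) (\<delta> b)" if "b \<in> galilei_basis" for b
        using that by (cases rule: galilei_basis_cases) (simp_all add: D'0 \<delta> c \<delta>p)
    qed
    then have "D = (\<lambda>x. scl (2 * c) (\<delta> x) + ad bracket a x)"
      by (simp add: D'_def fun_eq_iff algebra_simps)
    then show ?thesis by blast
  qed
  have combine: "(\<lambda>x. scl c (\<delta> x) + ad bracket a x) \<in> derivations scl bracket" for c a
    using derivations_add[OF derivations_scale[OF \<delta>_der] ad_in_derivations] .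
  have "derivations scl bracket = {\<lambda>x. u x + v x | u v. u \<in> ?C \<and> v \<in> range (ad bracket)}"
  proof (intro equalityI subsetI)
    fix D assume D: "D \<in> derivations scl bracket"
    obtain c a where "D = (\<lambda>x. scl c (\<delta> x) + ad bracket a x)"
      using decompose[OF D] by metis
    then show "D \<in> {\<lambda>x. u x + v x | u v. u \<in> ?C \<and> v \<in> range (ad bracket)}"
      by (intro CollectI exI[of _ "\<lambda>x. scl c (\<delta> x)"] exI[of _ "ad bracket a"]) auto
  next
    fix D assume "D \<in> {\<lambda>x. u x + v x | u v. u \<in> ?C \<and> v \<in> range (ad bracket)}"
    then show "D \<in> derivations scl bracket" by clarify (rule combine)
  qed
  moreover have "?C \<inter> range (ad bracket) = {\<lambda>x. 0}"
  proof (intro equalityI subsetI)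
    fix u assume "u \<in> ?C \<inter> range (ad bracket)"
    then obtain c a where c: "u = (\<lambda>x. scl c (\<delta> x))" and a: "u = ad bracket a" by auto
    have "scl c z = bracket a z"
      using fun_cong[OF c, of z] fun_cong[OF a, of z] \<delta> by (simp add: ad_def)
    then have "c = 0" using generators_nonzero(4) by (simp add: bracket_z_right)
    then show "u \<in> {\<lambda>x. 0}" using c by simp
  next
    fix u :: "'a \<Rightarrow> 'a" assume "u \<in> {\<lambda>x. 0}"
    then have "u = (\<lambda>x. scl 0 (\<delta> x))" "u = ad bracket 0"
      by (auto simp: ad_def bracket_zero_left)
    then show "u \<in> ?C \<inter> range (ad bracket)" by blast
  qed
  ultimately show ?thesis unfolding is_direct_sum_def by blast
qed

end
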